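(* For every integer $n\ge 1$, $$F_{2n+1}F_{2n}\,C_{n,F}-F_{n+1}F_n\,C_{n+1,F}=(-1)^nF_nF_{2n+1}\frac{F_{2n}!}{F_{n+2}!\,F_n!}=(-1)^n\binom{2n+1}{n+2}_F.$$
   Context: $F_n$ denotes the Fibonacci numbers: $F_0=0$, $F_1=1$, $F_n=F_{n-1}+F_{n-2}$ for $n\ge 2$. The notation $F_n!$ means the product $F_nF_{n-1}\cdots F_2F_1$ for $n\ge 1$ (not the factorial of the integer $F_n$), and $F_0!=1$. The fibonomial coefficients are, for $0\le k\le n$, $\binom{n}{k}_F=\frac{F_n!}{F_k!\,F_{n-k}!}$ (and $0$ when $k>n\ge 0$). The FiboCatalan numbers are $C_{n,F}=\frac{1}{F_{n+1}}\binom{2n}{n}_F$. *)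

theory Defs
  imports Complex_Main "HOL-Number_Theory.Fib"
begin

definition fib_fact :: "nat \<Rightarrow> nat" where
  "fib_fact n = (\<Prod>i = 1..n. fib i)"

text \<open>
  The coefficients below are defined by quotients in the rationals, so that neither truncating
  division nor a prior proof of integrality enters the definitions.
\<close>

definition fibonomial :: "nat \<Rightarrow> nat \<Rightarrow> rat" where
  "fibonomial n k =
     (if k \<le> n then of_nat (fib_fact n) / (of_nat (fib_fact k) * of_nat (fib_fact (n - k))) else 0)"

definition fibo_catalan :: "nat \<Rightarrow> rat" where
  "fibo_catalan n = 1 / of_nat (fib (n + 1)) * fibonomial (2 * n) n"

end

theory Submission
  imports Defs
begin

text \<open>
  All terms are multiples of \<open>F\<^bsub>2n+1\<^esub> F\<^bsub>2n\<^esub>! / (F\<^bsub>n+2\<^esub>! F\<^sub>n!)\<close>.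
  After division by it, the first equation reads
  \<open>F\<^bsub>2n\<^esub> F\<^bsub>n+2\<^esub> - F\<^sub>n F\<^bsub>2n+2\<^esub> = (-1)\<^sup>n F\<^sub>n\<close>,
  which is an instance of d'Ocagne's identity.
\<close>

lemma fib_fact_Suc: "fib_fact (Suc n) = fib (Suc n) * fib_fact n"
  by (simp add: fib_fact_def)

lemma fib_fact_pos: "fib_fact n > 0"
  by (auto simp: fib_fact_def intro!: prod_pos fib_neq_0_nat)

text \<open>Raising \<open>k\<close> by one only flips the sign: when the recurrence expands
  \<open>fib (k + 2)\<close> and \<open>fib (k + j + 2)\<close>, the two products
  \<open>fib (k + 1) * fib (k + j + 1)\<close> cancel. Casting to a ring avoids truncated
  subtraction.\<close>

lemma fib_dOcagne:
  "(of_nat (fib (k + j)) * of_nat (fib (k + 1)) - of_nat (fib k) * of_nat (fib (k + j + 1)) :: 'a::comm_ring_1)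
     = (-1) ^ k * of_nat (fib j)"
proof (induction k)
  case (Suc k)
  then show ?case by (simp add: algebra_simps)
qed simp

text \<open>Expanding \<open>fib (n + 2)\<close> and \<open>fib (2 * n + 2)\<close> once adds the
  same product \<open>fib n * fib (2 * n)\<close> to both terms; what remains is d'Ocagne with
  \<open>k = j = n\<close>.\<close>

lemma fib_double_identity:
  "(of_nat (fib (2 * n)) * of_nat (fib (n + 2)) - of_nat (fib n) * of_nat (fib (2 * n + 2)) :: 'a::comm_ring_1)
     = (-1) ^ n * of_nat (fib n)"
  using fib_dOcagne[of n n, where 'a = 'a]
  by (simp add: mult_2 mult_2_right algebra_simps)

theorem theorem4:
  fixes n :: nat
  assumes "n \<ge> 1"
  shows "of_nat (fib (2 * n + 1)) * of_nat (fib (2 * n)) * fibo_catalan n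
           - of_nat (fib (n + 1)) * of_nat (fib n) * fibo_catalan (n + 1)
         = (-1) ^ n * of_nat (fib n) * of_nat (fib (2 * n + 1))
             * ((of_nat (fib_fact (2 * n)) :: rat) / (of_nat (fib_fact (n + 2)) * of_nat (fib_fact n)))
       \<and> (-1) ^ n * of_nat (fib n) * of_nat (fib (2 * n + 1))
             * ((of_nat (fib_fact (2 * n)) :: rat) / (of_nat (fib_fact (n + 2)) * of_nat (fib_fact n)))
         = (-1) ^ n * fibonomial (2 * n + 1) (n + 2)"
proof -
  let ?F = "\<lambda>k. of_nat (fib k) :: rat"
  let ?G = "\<lambda>k. of_nat (fib_fact k) :: rat"
  let ?Q = "?F (2 * n + 1) * ?G (2 * n) / (?G (n + 2) * ?G n)"
  have nz: "?G k \<noteq> 0" for k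
    using fib_fact_pos[of k] by simp
  have Fnz: "?F k \<noteq> 0" if "k > 0" for k
    using fib_neq_0_nat[OF that] by simp
  have G_step: "?G (k + 1) = ?F (k + 1) * ?G k" for k
    by (simp add: fib_fact_Suc)
  have G_n2: "?G (n + 2) = ?F (n + 2) * (?F (n + 1) * ?G n)"
    using G_step[of "n + 1"] G_step[of n] by simp
  have G_2n2: "?G (2 * (n + 1)) = ?F (2 * n + 2) * (?F (2 * n + 1) * ?G (2 * n))"
    using G_step[of "2 * n + 1"] G_step[of "2 * n"] by simp
  have C_n: "fibo_catalan n = 1 / ?F (n + 1) * (?G (2 * n) / (?G n * ?G n))"
    by (simp add: fibo_catalan_def fibonomial_def mult_2)
  have "fibo_catalan (n + 1) = 1 / ?F (n + 2) * (?G (2 * (n + 1)) / (?G (n + 1) * ?G (n + 1)))"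
    unfolding fibo_catalan_def fibonomial_def by (simp add: mult_2 del: fib.simps)
  then have C_Suc: "fibo_catalan (n + 1) = 1 / ?F (n + 2) *
      (?F (2 * n + 2) * (?F (2 * n + 1) * ?G (2 * n)) / ((?F (n + 1) * ?G n) * (?F (n + 1) * ?G n)))"
    unfolding G_2n2 G_step[of n] .
  \<comment> \<open>The factor \<open>1 / ?F (n + 1)\<close> turns one \<open>?G n\<close> in the
    denominator into \<open>?G (n + 1)\<close>; multiplying and dividing by
    \<open>?F (n + 2)\<close> completes it to \<open>?G (n + 2)\<close>.\<close>
  have first_term: "?F (2 * n + 1) * ?F (2 * n) * fibo_catalan n = ?F (2 * n) * ?F (n + 2) * ?Q"
    unfolding C_n G_n2 using nz[of n] Fnz[of "n + 1"] Fnz[of "n + 2"]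
    by (simp add: divide_simps del: fib.simps)
  \<comment> \<open>The prefactor \<open>?F (n + 1)\<close> cancels one of the two in the
    denominator; the other joins \<open>?F (n + 2)\<close> and \<open>?G n\<close> to form
    \<open>?G (n + 2)\<close>.\<close>
  have second_term: "?F (n + 1) * ?F n * fibo_catalan (n + 1) = ?F n * ?F (2 * n + 2) * ?Q"
    unfolding C_Suc G_n2 using nz[of n] Fnz[of "n + 1"] Fnz[of "n + 2"]
    by (simp add: divide_simps del: fib.simps)
  have "?F (2 * n + 1) * ?F (2 * n) * fibo_catalan n - ?F (n + 1) * ?F n * fibo_catalan (n + 1)
      = (?F (2 * n) * ?F (n + 2) - ?F n * ?F (2 * n + 2)) * ?Q"
    unfolding first_term second_term by (simp only: left_diff_distrib)
  also have "\<dots> = (-1) ^ n * ?F n * ?F (2 * n + 1) * (?G (2 * n) / (?G (n + 2) * ?G n))"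
    unfolding fib_double_identity by simp
  finally have first: "?F (2 * n + 1) * ?F (2 * n) * fibo_catalan n
      - ?F (n + 1) * ?F n * fibo_catalan (n + 1)
      = (-1) ^ n * ?F n * ?F (2 * n + 1) * (?G (2 * n) / (?G (n + 2) * ?G n))" .
  have G_n: "?G n = ?F n * ?G (n - 1)"
    using G_step[of "n - 1"] assms by simp
  \<comment> \<open>For \<open>n \<ge> 1\<close> we have \<open>n + 2 \<le> 2 * n + 1\<close>, so
    the quotient branch applies, with difference \<open>n - 1\<close>.\<close>
  have "fibonomial (2 * n + 1) (n + 2) = ?G (2 * n + 1) / (?G (n + 2) * ?G (n - 1))"
    using assms by (simp add: fibonomial_def)
  also have "\<dots> = ?F n * ?F (2 * n + 1) * (?G (2 * n) / (?G (n + 2) * ?G n))"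
    unfolding G_step[of "2 * n"] G_n using assms Fnz[of n] by simp
  finally have "(-1) ^ n * ?F n * ?F (2 * n + 1) * (?G (2 * n) / (?G (n + 2) * ?G n))
      = (-1) ^ n * fibonomial (2 * n + 1) (n + 2)"
    by (simp only: mult.assoc)
  with first show ?thesis
    by (rule conjI)
qed

end
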